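(* Let $k$ be an algebraically closed field of characteristic zero. Let $f,g,h\in k(x)$ with $f(x)=g(h(x))$, $\deg g\ge 2$, $\deg h\geq 2$, and $g$ not of the shape $(\lambda(x))^m$ with $m\in\mathbb{N}$, $\lambda\in PGL_2(k)$. Suppose that $f$ has exactly $3$ zeros and poles altogether (in $k$). Then $f$ is equivalent (in the sense defined in the context) to one of the following rational functions: (a) $\dfrac{(x-\alpha_1)^{k_1}(x+1/4-\alpha_1)^{2k_2}}{(x-1/4-\alpha_1)^{2k_1+2k_2}}$ for some $\alpha_1\in k$ and $k_1,k_2\in\mathbb{Z}$, $k_1+k_2\neq 0$; (b) $\dfrac{(x-\alpha_1)^{2k_1}(x+\alpha_1-2\alpha_2)^{2k_2}}{(x-\alpha_2)^{2k_1+2k_2}}$ for some $\alpha_1,\alpha_2\in k$ and $k_1,k_2\in\mathbb{Z}$, $k_1+k_2\neq 0$; (c) $\left(x-\dfrac{\alpha_1+\alpha_2}{2}\right)^{2k_1}(x-\alpha_1)^{k_2}(x-\alpha_2)^{k_2}$ for some $\alpha_1,\alpha_2\in k$ and $k_1,k_2\in\mathbb{Z}$, $k_1+k_2\neq 0$.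
   Context: Equivalence: two rational functions $f_1(x)=\prod_{u=1}^n(x-\alpha_u^{(1)})^{f_u^{(1)}}$ and $f_2(x)=\prod_{u=1}^n(x-\alpha_u^{(2)})^{f_u^{(2)}}$ (with integer exponents, the zeros and poles being listed in some order) are equivalent if there exist $a_{u,v}\in\mathbb{Q}$, $u\in\{1,\ldots,n\}$, $v\in\{1,\ldots,n+1\}$, such that $$\alpha_u^{(1)}=a_{u,1}\alpha_1^{(2)}+a_{u,2}\alpha_2^{(2)}+\cdots+a_{u,n}\alpha_n^{(2)}+a_{u,n+1}$$ for all $u\in\{1,\ldots,n\}$. A nonzero constant factor of a rational function is disregarded: $c\prod_u(x-\alpha_u)^{f_u}$ with $c\in k\setminus\{0\}$ is treated as $\prod_u(x-\alpha_u)^{f_u}$. Here $n=3$. The degree of a rational function $p/q$ with $p,q$ coprime polynomials is $\max(\deg p,\deg q)$. An element $\lambda\in PGL_2(k)$ is viewed as the fractional linear function $\lambda(x)=\frac{ax+b}{cx+e}$ with $ae-bc\ne 0$. *)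

theory Defs
  imports "HOL-Computational_Algebra.Computational_Algebra"
begin

type_synonym 'a ratfun = "'a poly fract"

abbreviation (input) quot :: "'a::field poly \<Rightarrow> 'a poly \<Rightarrow> 'a ratfun" where
  "quot p q \<equiv> Fraction_Field.Fract p q"

definition ratfun_const :: "'a::field \<Rightarrow> 'a ratfun" where
  "ratfun_const c = to_fract [:c:]"

definition ratfun_X :: "'a::field ratfun" where
  "ratfun_X = to_fract [:0, 1:]"


text \<open>
  The representation in lowest terms, made unique by a monic denominator.  The function
  \<open>quot_of_fract\<close> is not used because it would need a \<open>gcd\<close> on the coefficient type.
\<close>

definition num_den :: "'a::field ratfun \<Rightarrow> 'a poly \<times> 'a poly" where
  "num_den f = (THE (p, q). coprime p q \<and> lead_coeff q = 1 \<and> f = quot p q)"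

definition ratfun_num :: "'a::field ratfun \<Rightarrow> 'a poly" where
  "ratfun_num f = fst (num_den f)"

definition ratfun_den :: "'a::field ratfun \<Rightarrow> 'a poly" where
  "ratfun_den f = snd (num_den f)"

lemma lowest_terms_exist:
  fixes f :: "'a::field ratfun"
  shows "\<exists>p q. coprime p q \<and> lead_coeff q = 1 \<and> f = quot p q"
proof -
  define P where "P = (\<lambda>n. \<exists>p q. q \<noteq> 0 \<and> f = quot p q \<and> degree q = n)"
  obtain p0 q0 where "f = quot p0 q0" "q0 \<noteq> 0"
    by (cases f) auto
  hence "P (degree q0)"
    by (auto simp: P_def)
  hence "P (LEAST n. P n)"
    by (rule LeastI)
  then obtain p q where pq: "q \<noteq> 0" "f = quot p q" "degree q = (LEAST n. P n)"
    by (auto simp: P_def)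
  have cop: "coprime p q"
  proof (rule coprimeI)
    fix d assume "d dvd p" "d dvd q"
    then obtain p' q' where d: "p = d * p'" "q = d * q'"
      by (auto elim!: dvdE)
    have nz: "d \<noteq> 0" "q' \<noteq> 0"
      using pq(1) d by auto
    have "f = quot p' q'"
      using pq(2) d nz by (simp add: eq_fract)
    hence "P (degree q')"
      using nz by (auto simp: P_def)
    hence "degree q \<le> degree q'"
      unfolding pq(3) by (rule Least_le)
    hence "degree d = 0"
      using d(2) nz by (simp add: degree_mult_eq)
    thus "is_unit d"
      using nz by (simp add: is_unit_iff_degree)
  qed
  define c where "c = inverse (lead_coeff q)"
  have c: "c \<noteq> 0" "c * lead_coeff q = 1"
    using pq(1) by (auto simp: c_def)
  have "coprime (smult c p) (smult c q)"
  proof (rule coprimeI)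
    fix d assume "d dvd smult c p" "d dvd smult c q"
    hence "d dvd p" "d dvd q"
      using c(1) by (auto simp: dvd_smult_iff)
    thus "is_unit d"
      using cop by (meson coprime_common_divisor)
  qed
  moreover have "lead_coeff (smult c q) = 1"
    using c by simp
  moreover have "f = quot (smult c p) (smult c q)"
    using pq c(1) by (simp add: eq_fract)
  ultimately show ?thesis
    by blast
qed

lemma lowest_terms_unique:
  fixes p q p' q' :: "'a::field poly"
  assumes "coprime p q" "lead_coeff q = 1" "coprime p' q'" "lead_coeff q' = 1"
    and "quot p q = quot p' q'"
  shows "p = p' \<and> q = q'"
proof -
  have nz: "q \<noteq> 0" "q' \<noteq> 0"
    using assms by auto
  have eq: "p * q' = p' * q"
    using assms(5) nz by (simp add: eq_fract)
  have coprime_dvd: "a dvd c" if ab: "coprime a b" "a dvd b * c" for a b c :: "'a poly"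
  proof -
    define S where "S = {e. \<exists>x y. e = x * a + y * b \<and> e \<noteq> 0}"
    show ?thesis
    proof (cases "S = {}")
      case True
      have "1 * a + 0 * b \<notin> S" "0 * a + 1 * b \<notin> S"
        using True by auto
      hence "a = 0" "b = 0"
        unfolding S_def by (metis (mono_tags, lifting) add_0_left add_0_right mem_Collect_eq mult_1 mult_zero_left)+
      thus ?thesis using ab by simp
    next
      case False
      define e where "e = arg_min degree (\<lambda>e. e \<in> S)"
      have e: "e \<in> S" and min: "\<And>e'. e' \<in> S \<Longrightarrow> degree e \<le> degree e'"
        using False arg_min_natI[of "\<lambda>e. e \<in> S" _ degree] arg_min_nat_le[of "\<lambda>e. e \<in> S" _ degree]
        by (auto simp: e_def)
      obtain x y where xy: "e = x * a + y * b" "e \<noteq> 0"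
        using e by (auto simp: S_def)
      have dvd: "e dvd u * a + v * b" for u v
      proof (rule ccontr)
        define w where "w = u * a + v * b"
        assume "\<not> e dvd u * a + v * b"
        hence r: "w mod e \<noteq> 0"
          by (simp add: w_def mod_eq_0_iff_dvd)
        have "w mod e = (u - w div e * x) * a + (v - w div e * y) * b"
          using div_mult_mod_eq[of w e] by (simp add: w_def xy(1) algebra_simps)
        hence "w mod e \<in> S"
          using r by (auto simp: S_def)
        moreover have "degree (w mod e) < degree e"
          using degree_mod_less[OF xy(2), of w] r by simp
        ultimately show False
          using min by fastforce
      qed
      have "e dvd a" "e dvd b"
        using dvd[of 1 0] dvd[of 0 1] by simp_all
      hence "is_unit e"
        using ab(1) by (meson coprime_common_divisor)
      have "a dvd (x * c) * a + y * (b * c)"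
        using ab(2) by simp
      also have "\<dots> = e * c"
        by (simp add: xy(1) algebra_simps)
      finally show ?thesis
        using \<open>is_unit e\<close> by (simp add: dvd_mult_unit_iff')
    qed
  qed
  have "q dvd q'"
    by (rule coprime_dvd[of q p]) (use assms eq in \<open>auto simp: coprime_commute\<close>)
  moreover have "q' dvd q"
    by (rule coprime_dvd[of q' p']) (use assms eq[symmetric] in \<open>auto simp: coprime_commute\<close>)
  ultimately have deg: "degree q = degree q'"
    using nz by (intro antisym dvd_imp_degree_le)
  obtain r where r: "q' = q * r"
    using \<open>q dvd q'\<close> by (elim dvdE)
  hence "degree r = 0"
    using deg nz by (auto simp: degree_mult_eq)
  then obtain x where "r = [:x:]"
    by (auto elim: degree_eq_zeroE)
  hence "q = q'"
    using r assms(2,4) by (auto split: if_splits)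
  thus ?thesis
    using eq nz by simp
qed

lemma num_den_lowest_terms:
  "coprime (ratfun_num f) (ratfun_den f)"
  "lead_coeff (ratfun_den f) = 1"
  "f = quot (ratfun_num f) (ratfun_den f)"
proof -
  have "\<exists>!pq. case pq of (p, q) \<Rightarrow> coprime p q \<and> lead_coeff q = 1 \<and> f = quot p q"
    using lowest_terms_exist[of f] lowest_terms_unique by fastforce
  from theI'[OF this, folded num_den_def]
  show "coprime (ratfun_num f) (ratfun_den f)" "lead_coeff (ratfun_den f) = 1"
    "f = quot (ratfun_num f) (ratfun_den f)"
    unfolding ratfun_num_def ratfun_den_def by (auto simp: case_prod_beta)
qed


definition ratfun_degree :: "'a::field ratfun \<Rightarrow> nat" where
  "ratfun_degree f = max (degree (ratfun_num f)) (degree (ratfun_den f))"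

definition poly_at_ratfun :: "'a::field poly \<Rightarrow> 'a ratfun \<Rightarrow> 'a ratfun" where
  "poly_at_ratfun p h = poly (map_poly ratfun_const p) h"

text \<open>
  The composite \<open>g(h(x))\<close>.  If \<open>h\<close> is constant and equal to a pole of \<open>g\<close>, the value is the
  junk value \<open>0\<close> of a division by zero; for nonconstant \<open>h\<close> the denominator does not vanish.
\<close>

definition ratfun_compose :: "'a::field ratfun \<Rightarrow> 'a ratfun \<Rightarrow> 'a ratfun" where
  "ratfun_compose g h = poly_at_ratfun (ratfun_num g) h / poly_at_ratfun (ratfun_den g) h"

definition fractional_linear :: "'a::field ratfun set" where
  "fractional_linear = {quot [:b, a:] [:e, c:] | a b c e. a * e - b * c \<noteq> 0}"

text \<open>Zeros and poles in the field itself, so the point at infinity does not count.\<close>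

definition zeros_and_poles :: "'a::field ratfun \<Rightarrow> 'a set" where
  "zeros_and_poles f = {z. poly (ratfun_num f) z = 0 \<or> poly (ratfun_den f) z = 0}"

text \<open>
  \<open>factored_as n f \<alpha> e\<close>: up to a nonzero constant factor, \<open>f\<close> is the product of the
  \<open>(x - \<alpha> u) ^ e u\<close> for \<open>u = 1, \<dots>, n\<close>, where \<open>\<alpha> 1, \<dots>, \<alpha> n\<close> lists each zero and
  pole of \<open>f\<close> exactly once.
\<close>

definition factored_as :: "nat \<Rightarrow> 'a::field ratfun \<Rightarrow> (nat \<Rightarrow> 'a) \<Rightarrow> (nat \<Rightarrow> int) \<Rightarrow> bool" where
  "factored_as n f \<alpha> e \<longleftrightarrow>
     inj_on \<alpha> {1..n} \<and> (\<forall>u\<in>{1..n}. e u \<noteq> 0) \<and>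
     (\<exists>c. c \<noteq> 0 \<and>
        f = ratfun_const c * (\<Prod>u=1..n. (ratfun_X - ratfun_const (\<alpha> u)) powi e u))"

text \<open>
  The relation is directed, from the zeros and poles of \<open>f\<^sub>2\<close> to those of \<open>f\<^sub>1\<close>, and does not
  compare the exponents of \<open>f\<^sub>1\<close> with those of \<open>f\<^sub>2\<close>.
\<close>

definition ratfun_equivalent :: "nat \<Rightarrow> 'a::field_char_0 ratfun \<Rightarrow> 'a ratfun \<Rightarrow> bool" where
  "ratfun_equivalent n f\<^sub>1 f\<^sub>2 \<longleftrightarrow>
     (\<exists>\<alpha>\<^sub>1 e\<^sub>1 \<alpha>\<^sub>2 e\<^sub>2. factored_as n f\<^sub>1 \<alpha>\<^sub>1 e\<^sub>1 \<and> factored_as n f\<^sub>2 \<alpha>\<^sub>2 e\<^sub>2 \<and>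
        (\<exists>a :: nat \<Rightarrow> nat \<Rightarrow> rat. \<forall>u\<in>{1..n}.
           \<alpha>\<^sub>1 u = (\<Sum>v=1..n. of_rat (a u v) * \<alpha>\<^sub>2 v) + of_rat (a u (n + 1))))"

definition family_a :: "'a::field_char_0 \<Rightarrow> int \<Rightarrow> int \<Rightarrow> 'a ratfun" where
  "family_a \<alpha>\<^sub>1 k\<^sub>1 k\<^sub>2 =
     (ratfun_X - ratfun_const \<alpha>\<^sub>1) powi k\<^sub>1
       * (ratfun_X + ratfun_const (1/4) - ratfun_const \<alpha>\<^sub>1) powi (2 * k\<^sub>2)
     / (ratfun_X - ratfun_const (1/4) - ratfun_const \<alpha>\<^sub>1) powi (2 * k\<^sub>1 + 2 * k\<^sub>2)"

definition family_b :: "'a::field_char_0 \<Rightarrow> 'a \<Rightarrow> int \<Rightarrow> int \<Rightarrow> 'a ratfun" where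
  "family_b \<alpha>\<^sub>1 \<alpha>\<^sub>2 k\<^sub>1 k\<^sub>2 =
     (ratfun_X - ratfun_const \<alpha>\<^sub>1) powi (2 * k\<^sub>1)
       * (ratfun_X + ratfun_const \<alpha>\<^sub>1 - ratfun_const (2 * \<alpha>\<^sub>2)) powi (2 * k\<^sub>2)
     / (ratfun_X - ratfun_const \<alpha>\<^sub>2) powi (2 * k\<^sub>1 + 2 * k\<^sub>2)"

definition family_c :: "'a::field_char_0 \<Rightarrow> 'a \<Rightarrow> int \<Rightarrow> int \<Rightarrow> 'a ratfun" where
  "family_c \<alpha>\<^sub>1 \<alpha>\<^sub>2 k\<^sub>1 k\<^sub>2 =
     (ratfun_X - ratfun_const ((\<alpha>\<^sub>1 + \<alpha>\<^sub>2) / 2)) powi (2 * k\<^sub>1)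
       * (ratfun_X - ratfun_const \<alpha>\<^sub>1) powi k\<^sub>2
       * (ratfun_X - ratfun_const \<alpha>\<^sub>2) powi k\<^sub>2"

end

theory Submission
  imports Defs
begin

text \<open>
  Write \<open>h = p / q\<close> in lowest terms.  A rational function with at most two zeros and poles
  on the projective line is a power of a fractional linear function, so \<open>g\<close> has at least three.
  The fibres of \<open>h\<close> over three of them are cut out by pairwise coprime members \<open>A, B, C\<close> of the
  pencil spanned by \<open>p\<close> and \<open>q\<close>, scaled so that \<open>A + B + C = 0\<close>, and all their roots are zeros
  or poles of \<open>f\<close>.  By Mason-Stothers the degree of \<open>h\<close> is less than the number 3 of these
  points, hence equal to 2, and for a quadratic pencil one of the three points must be the
  midpoint of the other two.  Since equivalence ignores the exponents, this already makes \<open>f\<close>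
  equivalent to a member of family (c).
\<close>

subsection \<open>The Mason-Stothers inequality\<close>

text \<open>Points of \<open>Z\<close> that are not roots contribute an exponent 0. Allowing them
  makes it possible to factor a numerator and a denominator over one common index set.\<close>

lemma poly_eq_prod_roots:
  fixes p :: "'a::alg_closed_field poly"
  assumes "p \<noteq> 0" "finite Z" "{z. poly p z = 0} \<subseteq> Z"
  shows "p = smult (lead_coeff p) (\<Prod>z\<in>Z. [:-z, 1:] ^ order z p)"
proof -
  obtain A where A: "p = smult (lead_coeff p) (\<Prod>x\<in>#A. [:-x, 1:])"
    using alg_closed_imp_factorization[OF assms(1)] by blast
  have "proots p = proots (\<Prod>x\<in>#A. [:-x, 1:])"
    by (subst A, rule proots_smult) (use assms(1) in auto)
  also have "\<dots> = A"
  proof (induction A)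
    case (add x A)
    have "(\<Prod>x\<in>#A. [:-x, 1:]) \<noteq> 0"
      by (auto simp: prod_mset_zero_iff)
    hence "proots ([:-x, 1:] * (\<Prod>x\<in>#A. [:-x, 1:])) = {#x#} + proots (\<Prod>x\<in>#A. [:-x, 1:])"
      by (subst proots_mult) (auto simp del: mult_pCons_left)
    with add show ?case
      by (simp del: mult_pCons_left)
  qed simp
  finally have "A = proots p" ..
  hence "(\<Prod>x\<in>#A. [:-x, 1:]) = (\<Prod>x | poly p x = 0. [:-x, 1:] ^ order x p)"
    using assms(1) by (simp add: image_prod_mset_multiplicity)
  also have "\<dots> = (\<Prod>z\<in>Z. [:-z, 1:] ^ order z p)"
    by (intro prod.mono_neutral_left) (use assms in \<open>auto simp: order_root\<close>)
  finally show ?thesis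
    using A by simp
qed

lemma sum_order_eq_degree:
  fixes p :: "'a::alg_closed_field poly"
  assumes "p \<noteq> 0" "finite Z" "{z. poly p z = 0} \<subseteq> Z"
  shows "(\<Sum>z\<in>Z. order z p) = degree p"
proof -
  have "degree p = degree (\<Prod>z\<in>Z. [:-z, 1:] ^ order z p)"
    by (subst poly_eq_prod_roots[OF assms]) (use assms(1) in simp)
  also have "\<dots> = (\<Sum>z\<in>Z. order z p)"
    by (subst degree_prod_sum_eq) (auto simp: degree_power_eq)
  finally show ?thesis ..
qed

definition wronskian :: "'a::idom poly \<Rightarrow> 'a poly \<Rightarrow> 'a poly" where
  "wronskian p q = pderiv p * q - p * pderiv q"

lemma wronskian_commute: "wronskian q p = - wronskian p q"
  by (simp add: wronskian_def algebra_simps)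

text \<open>Substituting \<open>r = - (p + q)\<close> leaves \<open>- wronskian q p\<close>, because
  \<open>wronskian q q\<close> vanishes. Hence all cyclic pairs of a triple with sum 0 share a
  single Wronskian.\<close>

lemma wronskian_eq_if_sum_0:
  assumes "p + q + r = 0"
  shows "wronskian q r = wronskian p q"
proof -
  have r: "r = - (p + q)"
    using assms by (simp only: eq_neg_iff_add_eq_0 add.commute[of r])
  show ?thesis
    unfolding r by (simp add: wronskian_def pderiv_add pderiv_diff pderiv_minus algebra_simps)
qed

lemma degree_wronskian:
  fixes p q :: "'a::field_char_0 poly"
  assumes "degree p + degree q > 0"
  shows "degree (wronskian p q) < degree p + degree q"
proof -
  have "degree (pderiv p * q) < degree p + degree q"
  proof (cases "degree p = 0")
    case True
    hence "pderiv p = 0"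
      by (auto elim: degree_eq_zeroE simp: pderiv_pCons)
    thus ?thesis using assms by simp
  next
    case False
    thus ?thesis
      using degree_mult_le[of "pderiv p" q] degree_pderiv[of p] by linarith
  qed
  moreover have "degree (p * pderiv q) < degree p + degree q"
  proof (cases "degree q = 0")
    case True
    hence "pderiv q = 0"
      by (auto elim: degree_eq_zeroE simp: pderiv_pCons)
    thus ?thesis using assms by simp
  next
    case False
    thus ?thesis
      using degree_mult_le[of p "pderiv q"] degree_pderiv[of q] by linarith
  qed
  ultimately show ?thesis
    unfolding wronskian_def by (rule degree_diff_less)
qed

text \<open>In characteristic zero, differentiation lowers the multiplicity of a root by exactly
  one, so \<open>[:-z, 1:] ^ n\<close> divides both terms of the Wronskian when \<open>p\<close> has
  order \<open>n + 1\<close> at \<open>z\<close>.\<close>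

lemma order_le_order_wronskian:
  fixes p q :: "'a::field_char_0 poly"
  assumes "wronskian p q \<noteq> 0"
  shows "order z p \<le> order z (wronskian p q) + 1"
proof (cases "p \<noteq> 0 \<and> poly p z = 0")
  case True
  define n where "n = order z (pderiv p)"
  have n: "order z p = Suc n"
    using True order_pderiv n_def by blast
  have "[:-z, 1:] ^ n dvd pderiv p"
    by (simp add: n_def order_1)
  moreover have "[:-z, 1:] ^ n dvd p"
    using n by (simp add: order_divides)
  ultimately have "[:-z, 1:] ^ n dvd wronskian p q"
    unfolding wronskian_def by (intro dvd_diff dvd_mult2)
  thus ?thesis
    using assms n by (simp add: order_divides)
next
  case False
  thus ?thesis
    using assms by (auto simp: order_0I wronskian_def)
qed

text \<open>If it vanished, then \<open>pderiv p * q = p * pderiv q\<close>. At a root of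
  \<open>p\<close> the left side has order one less than \<open>p\<close>, since \<open>q\<close>
  does not vanish there, while the right side has at least the order of \<open>p\<close>.\<close>

lemma wronskian_nonzero:
  fixes p q :: "'a::{alg_closed_field, field_char_0} poly"
  assumes "q \<noteq> 0" "degree p > 0" "\<And>z. poly p z = 0 \<Longrightarrow> poly q z \<noteq> 0"
  shows "wronskian p q \<noteq> 0"
proof
  assume "wronskian p q = 0"
  hence eq: "pderiv p * q = p * pderiv q"
    by (simp add: wronskian_def)
  have nz: "p \<noteq> 0" "pderiv p \<noteq> 0"
    using assms(2) by (auto simp: pderiv_eq_0_iff)
  obtain z where z: "poly p z = 0"
    using assms(2) alg_closed_imp_poly_has_root by blast
  have "pderiv q \<noteq> 0"
    using eq nz assms(1) by (metis mult_eq_0_iff)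
  hence "order z (pderiv p) + order z q = order z p + order z (pderiv q)"
    using eq nz assms(1) by (metis mult_eq_0_iff order_mult)
  moreover have "order z q = 0"
    using assms(3)[OF z] by (simp add: order_0I)
  ultimately show False
    using order_pderiv[OF nz(1) z] by simp
qed

text \<open>At each point at most one of \<open>A\<close>, \<open>B\<close>, \<open>C\<close>
  vanishes, so the sum of their orders exceeds that of the common Wronskian by at most 1. Summing
  over \<open>Z\<close> bounds the three degrees together by \<open>degree W + card Z\<close>, and
  \<open>degree W < degree A + degree B\<close>.\<close>

lemma Mason_Stothers:
  fixes A B C :: "'a::{alg_closed_field, field_char_0} poly"
  assumes sum: "A + B + C = 0"
    and nz: "A \<noteq> 0" "B \<noteq> 0" "C \<noteq> 0"
    and AB: "\<And>z. poly A z = 0 \<Longrightarrow> poly B z \<noteq> 0"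
    and deg: "degree A + degree B > 0"
    and Z: "finite Z" "{z. poly (A * B * C) z = 0} \<subseteq> Z"
  shows "degree C < card Z"
proof -
  define W where "W = wronskian A B"
  have W: "W = wronskian B C" "W = wronskian C A"
    using wronskian_eq_if_sum_0[of A B C] wronskian_eq_if_sum_0[of B C A] sum
    by (simp_all add: W_def algebra_simps)
  \<comment> \<open>Nonvanishing of the Wronskian requires a first argument of positive degree; this
    is \<open>A\<close> or, after a change of sign, \<open>B\<close>.\<close>
  have "W \<noteq> 0"
  proof (cases "degree A > 0")
    case True
    thus ?thesis
      unfolding W_def using AB nz by (intro wronskian_nonzero) auto
  next
    case False
    hence "wronskian B A \<noteq> 0"
      using AB nz deg by (intro wronskian_nonzero) auto
    thus ?thesis
      using wronskian_commute[of B A] by (simp add: W_def)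
  qed
  have ord: "order z A + order z B + order z C \<le> order z W + 1" for z
  proof -
    have "poly A z + poly B z + poly C z = 0"
      using sum by (metis poly_0 poly_add)
    hence "(poly A z \<noteq> 0 \<and> poly B z \<noteq> 0) \<or> (poly A z \<noteq> 0 \<and> poly C z \<noteq> 0)
        \<or> (poly B z \<noteq> 0 \<and> poly C z \<noteq> 0)"
      using AB by force
    thus ?thesis
      using order_le_order_wronskian[of A B z] order_le_order_wronskian[of B C z]
        order_le_order_wronskian[of C A z] W \<open>W \<noteq> 0\<close>
      by (auto simp: order_0I W_def)
  qed
  have "degree A + degree B + degree C = (\<Sum>z\<in>Z. order z A + order z B + order z C)"
    unfolding sum.distrib using nz Z
    by (intro arg_cong2[of _ _ _ _ "(+)"] sum_order_eq_degree[symmetric]) auto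
  also have "\<dots> \<le> (\<Sum>z\<in>Z. order z W + 1)"
    by (intro sum_mono ord)
  also have "\<dots> = (\<Sum>z\<in>Z \<inter> {z. poly W z = 0}. order z W) + card Z"
    unfolding sum.distrib using Z(1) \<open>W \<noteq> 0\<close>
    by (auto intro!: sum.mono_neutral_right simp: order_gt_0_iff)
  also have "(\<Sum>z\<in>Z \<inter> {z. poly W z = 0}. order z W) \<le> (\<Sum>z | poly W z = 0. order z W)"
    using \<open>W \<noteq> 0\<close> by (intro sum_mono2) (auto simp: poly_roots_finite)
  also have "\<dots> \<le> degree W"
    by (rule sum_order_le_degree) fact
  finally show ?thesis
    using degree_wronskian[OF deg] by (simp add: W_def)
qed

subsection \<open>Pencils whose three members have three roots altogether\<close>

lemma degree_2_factorization:
  fixes p :: "'a::alg_closed_field poly"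
  assumes "degree p = 2"
  obtains a r s where "a \<noteq> 0" "p = smult a ([:-r, 1:] * [:-s, 1:])"
proof -
  have "p \<noteq> 0"
    using assms by auto
  then obtain M where M: "size M = 2" "p = smult (lead_coeff p) (\<Prod>x\<in>#M. [:-x, 1:])"
    using alg_closed_imp_factorization assms by metis
  then obtain r s where "M = {#r, s#}"
    by (metis One_nat_def numeral_2_eq_2 size_1_singleton_mset size_eq_Suc_imp_eq_union
        size_add_mset old.nat.inject)
  thus ?thesis
    using that[of "lead_coeff p" r s] M \<open>p \<noteq> 0\<close> by (simp del: mult_pCons_left)
qed

lemma card_3_eqI: "card Z = 3 \<Longrightarrow> {x, y, z} \<subseteq> Z \<Longrightarrow> distinct [x, y, z] \<Longrightarrow> Z = {x, y, z}"
  by (rule card_subset_eq[symmetric]) (auto intro: card_ge_0_finite)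

text \<open>If \<open>t\<close> and \<open>u\<close> differ, then \<open>r\<close>,
  \<open>t\<close>, \<open>u\<close> exhaust \<open>Z\<close>, so \<open>C\<close> has no root and
  is constant, which makes \<open>r\<close> the midpoint of \<open>t\<close> and \<open>u\<close>.
  If they agree, \<open>C\<close> vanishes at the midpoint of \<open>r\<close> and \<open>t\<close>
  when \<open>a + b = 0\<close>, and otherwise has two further roots, too many for
  \<open>Z\<close>.\<close>

lemma quadratic_double_root_midpoint:
  fixes A B C :: "'a::{alg_closed_field, field_char_0} poly"
  assumes sum: "A + B + C = 0"
    and AB: "\<And>z. poly A z = 0 \<Longrightarrow> poly B z \<noteq> 0"
    and Z: "card Z = 3" "{z. poly (A * B * C) z = 0} \<subseteq> Z"
    and A: "A = smult a ([:-r, 1:] * [:-r, 1:])" "a \<noteq> 0"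
    and B: "B = smult b ([:-t, 1:] * [:-u, 1:])" "b \<noteq> 0"
  shows "\<exists>x y. x \<noteq> y \<and> Z = {x, y, (x + y) / 2}"
proof -
  have C: "poly C x = - a * (x - r)\<^sup>2 - b * (x - t) * (x - u)" for x
  proof -
    have "poly A x + poly B x + poly C x = 0"
      using sum by (metis poly_0 poly_add)
    thus ?thesis
      unfolding A B by (simp add: power2_eq_square algebra_simps eq_neg_iff_add_eq_0)
  qed
  have AB_eq: "poly A x = a * (x - r) * (x - r)" "poly B x = b * (x - t) * (x - u)" for x
    by (simp_all add: A B algebra_simps)
  have ne: "r \<noteq> t" "r \<noteq> u"
    using AB[of r] by (auto simp: AB_eq)
  have rtu: "{r, t, u} \<subseteq> Z"
    using Z(2) by (auto simp: AB_eq)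
  have C_root: "x \<in> Z" "x \<noteq> r" "x \<noteq> t" "x \<noteq> u" if "poly C x = 0" for x
    using that Z(2) C[of x] ne A(2) B(2) by auto
  show ?thesis
  proof (cases "t = u")
    case False
    hence Zeq: "Z = {r, t, u}"
      using rtu ne by (intro card_3_eqI Z) auto
    hence "poly C x \<noteq> 0" for x
      using C_root by auto
    hence "degree C = 0"
      using alg_closed_imp_poly_has_root by blast
    then obtain c where c: "C = [:c:]"
      by (rule degree_eq_zeroE)
    \<comment> \<open>As \<open>C\<close> is constant, the coefficients of \<open>x^2\<close> and of
      \<open>x\<close> in \<open>A + B\<close> vanish.\<close>
    have "a + b = 0"
      using arg_cong[OF sum, of "\<lambda>p. coeff p 2"] unfolding A B c by (simp add: numeral_2_eq_2)
    hence "b = - a"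
      by (simp add: add_eq_0_iff)
    moreover have "a * (- r - r) + b * (- u - t) = 0"
      using arg_cong[OF sum, of "\<lambda>p. coeff p 1"] unfolding A B c by simp
    ultimately have "a * (2 * r - (t + u)) = 0"
      by (simp add: algebra_simps)
    hence "2 * r - (t + u) = 0"
      using A(2) by simp
    hence "r = (t + u) / 2"
      by (simp add: field_simps)
    thus ?thesis
      using Zeq False by (intro exI[of _ t] exI[of _ u]) auto
  next
    case True
    show ?thesis
    proof (cases "a + b = 0")
      case True
      hence "poly C ((r + t) / 2) = 0"
        using \<open>t = u\<close> by (simp add: C power2_eq_square field_simps add_eq_0_iff2)
      from C_root[OF this] show ?thesis
        using rtu ne by (intro exI[of _ r] exI[of _ t] conjI card_3_eqI Z) auto
    next
      case False
      \<comment> \<open>The equation \<open>poly C x = 0\<close> says that the square of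
        \<open>(x - r) / (x - t)\<close> is \<open>- b / a\<close>. Solving
        \<open>x - r = w * (x - t)\<close> for \<open>w = s\<close> and \<open>w = - s\<close> gives
        two roots; \<open>a + b \<noteq> 0\<close> keeps \<open>w\<close> away from 1.\<close>
      obtain s where s: "s\<^sup>2 = - b / a"
        using nth_root_exists[of 2] by auto
      have s1: "s \<noteq> 1" "s \<noteq> -1" "s \<noteq> 0"
        using s A(2) B(2) False by (auto simp: field_simps add_eq_0_iff2)
      have root: "poly C ((r - w * t) / (1 - w)) = 0" if w: "w\<^sup>2 = - b / a" "w \<noteq> 1" for w
      proof -
        define x where "x = (r - w * t) / (1 - w)"
        have "x * (1 - w) = r - w * t"
          using w by (simp add: x_def)
        hence "x - r = w * (x - t)"
          by (simp add: algebra_simps)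
        hence "a * (x - r)\<^sup>2 = a * w\<^sup>2 * (x - t)\<^sup>2"
          by (simp add: power_mult_distrib)
        also have "a * w\<^sup>2 = - b"
          using w A(2) by simp
        finally show ?thesis
          using \<open>t = u\<close> unfolding x_def[symmetric] C by (simp add: power2_eq_square mult.assoc)
      qed
      define x y where "x = (r - s * t) / (1 - s)" and "y = (r - (-s) * t) / (1 - (-s))"
      have "- s \<noteq> 1"
        using s1 by (metis minus_minus)
      hence xy: "poly C x = 0" "poly C y = 0"
        unfolding x_def y_def using root[of s] root[of "- s"] s s1 by simp_all
      have "x \<noteq> y"
      proof
        assume "x = y"
        hence "(r - s * t) * (1 + s) = (r + s * t) * (1 - s)"
          using s1 by (simp add: x_def y_def frac_eq_eq eq_neg_iff_add_eq_0 add.commute)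
        hence "2 * s * (r - t) = 0"
          by (simp add: algebra_simps)
        thus False
          using s1 ne by simp
      qed
      hence "card {r, t, x, y} = 4"
        using C_root[OF xy(1)] C_root[OF xy(2)] ne by auto
      moreover have "card {r, t, x, y} \<le> card Z"
        using C_root(1)[OF xy(1)] C_root(1)[OF xy(2)] rtu Z(1)
        by (intro card_mono) (auto intro: card_ge_0_finite)
      ultimately show ?thesis
        using Z(1) by simp
    qed
  qed
qed

text \<open>If neither \<open>A\<close> nor \<open>B\<close> had a double root, their roots would be
  four points of \<open>Z\<close>. So one of them is a multiple of a square.\<close>

lemma quadratic_pencil_midpoint:
  fixes A B C :: "'a::{alg_closed_field, field_char_0} poly"
  assumes sum: "A + B + C = 0"
    and AB: "\<And>z. poly A z = 0 \<Longrightarrow> poly B z \<noteq> 0"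
    and Z: "card Z = 3" "{z. poly (A * B * C) z = 0} \<subseteq> Z"
    and deg: "degree A = 2" "degree B = 2"
  shows "\<exists>x y. x \<noteq> y \<and> Z = {x, y, (x + y) / 2}"
proof -
  obtain a r s where A: "a \<noteq> 0" "A = smult a ([:-r, 1:] * [:-s, 1:])"
    using degree_2_factorization[OF deg(1)] .
  obtain b t u where B: "b \<noteq> 0" "B = smult b ([:-t, 1:] * [:-u, 1:])"
    using degree_2_factorization[OF deg(2)] .
  consider "r = s" | "t = u" | "r \<noteq> s" "t \<noteq> u"
    by blast
  thus ?thesis
  proof cases
    case 1
    thus ?thesis
      using quadratic_double_root_midpoint[OF sum AB Z] A B by blast
  next
    case 2
    have "B + A + C = 0" "{z. poly (B * A * C) z = 0} \<subseteq> Z"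
      using sum Z(2) by (auto simp: add.commute)
    thus ?thesis
      using quadratic_double_root_midpoint[of B A C Z b t a r s, OF _ _ Z(1)] AB A B 2 by metis
  next
    case 3
    have AB_eq: "poly A x = a * (x - r) * (x - s)" "poly B x = b * (x - t) * (x - u)" for x
      by (simp_all add: A B algebra_simps)
    have "card {r, s, t, u} = 4"
      using 3 AB[of r] AB[of s] by (auto simp: AB_eq)
    moreover have "card {r, s, t, u} \<le> card Z"
    proof (rule card_mono)
      show "finite Z"
        using Z(1) by (intro card_ge_0_finite) simp
      show "{r, s, t, u} \<subseteq> Z"
        using Z(2) by (auto simp: AB_eq)
    qed
    ultimately show ?thesis
      using Z(1) by simp
  qed
qed

text \<open>Since the sum is 0, the largest degree is attained by at least two members. It is at
  least 2 by hypothesis and below 3 by Mason-Stothers, applied to all cyclic shifts, so two members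
  are quadratic.\<close>

lemma pencil_midpoint:
  fixes A B C :: "'a::{alg_closed_field, field_char_0} poly"
  assumes sum: "A + B + C = 0"
    and AB: "\<And>z. poly A z = 0 \<Longrightarrow> poly B z \<noteq> 0"
    and Z: "card Z = 3" "{z. poly (A * B * C) z = 0} \<subseteq> Z"
    and deg: "max (degree A) (degree B) \<ge> 2"
  shows "\<exists>x y. x \<noteq> y \<and> Z = {x, y, (x + y) / 2}"
proof -
  have sum': "B + C + A = 0" "C + A + B = 0"
    using sum by (simp_all add: algebra_simps)
  have vals: "poly A z + poly B z + poly C z = 0" for z
    using sum by (metis poly_0 poly_add)
  have BC: "poly C z \<noteq> 0" if "poly B z = 0" for z
    using vals[of z] AB[of z] that by auto
  have CA: "poly A z \<noteq> 0" if "poly C z = 0" for z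
    using vals[of z] AB[of z] that by auto
  have rootless: "degree p = 0" if "\<And>z. poly p z \<noteq> 0" for p :: "'a poly"
    using that alg_closed_imp_poly_has_root by blast
  have degs: "degree A \<le> max (degree B) (degree C)" "degree B \<le> max (degree C) (degree A)"
    "degree C \<le> max (degree A) (degree B)"
    using degree_add_le_max[of B C] degree_add_le_max[of C A] degree_add_le_max[of A B] sum
    by (metis add_eq_0_iff degree_minus sum')+
  \<comment> \<open>A zero member vanishes everywhere, so a member without common roots with it has
    no root and is constant; this contradicts the degree hypothesis.\<close>
  have nz: "A \<noteq> 0" "B \<noteq> 0" "C \<noteq> 0"
  proof -
    show "A \<noteq> 0"
    proof
      assume "A = 0"
      hence "degree B = 0" using AB by (intro rootless) auto
      thus False using deg \<open>A = 0\<close> by simp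
    qed
    show "B \<noteq> 0"
    proof
      assume "B = 0"
      hence "degree A = 0" using AB by (intro rootless) auto
      thus False using deg \<open>B = 0\<close> by simp
    qed
    show "C \<noteq> 0"
    proof
      assume "C = 0"
      hence "degree A = 0" "degree B = 0" using BC CA by (auto intro!: rootless)
      thus False using deg by simp
    qed
  qed
  have finZ: "finite Z"
    using Z(1) by (auto intro: card_ge_0_finite)
  have Z': "{z. poly (B * C * A) z = 0} \<subseteq> Z" "{z. poly (C * A * B) z = 0} \<subseteq> Z"
    using Z(2) by (auto simp: mult_ac)
  have "degree C < card Z"
    using deg by (intro Mason_Stothers[OF sum nz AB _ finZ Z(2)]) auto
  moreover have "degree A < card Z"
    using deg degs by (intro Mason_Stothers[OF sum'(1) nz(2,3,1) BC _ finZ Z'(1)]) auto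
  moreover have "degree B < card Z"
    using deg degs by (intro Mason_Stothers[OF sum'(2) nz(3,1,2) CA _ finZ Z'(2)]) auto
  ultimately consider "degree A = 2" "degree B = 2" | "degree B = 2" "degree C = 2"
    | "degree C = 2" "degree A = 2"
    using deg degs Z(1) by (auto simp: max_def split: if_splits)
  thus ?thesis
  proof cases
    case 1
    thus ?thesis using quadratic_pencil_midpoint[OF sum AB Z] by blast
  next
    case 2
    thus ?thesis using quadratic_pencil_midpoint[OF sum'(1) BC Z(1) Z'(1)] by blast
  next
    case 3
    thus ?thesis using quadratic_pencil_midpoint[OF sum'(2) CA Z(1) Z'(2)] by blast
  qed
qed

subsection \<open>Zeros and poles of rational functions\<close>

lemma to_fract_power: "to_fract (x ^ n) = to_fract x ^ n"
  by (induction n) simp_all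

lemma to_fract_prod: "to_fract (prod f A) = (\<Prod>x\<in>A. to_fract (f x))"
  by (induction A rule: infinite_finite_induct) simp_all

lemma coprime_no_common_root:
  fixes p q :: "'a::field poly"
  assumes "coprime p q" "poly p z = 0"
  shows "poly q z \<noteq> 0"
proof
  assume "poly q z = 0"
  hence "is_unit [:-z, 1:]"
    using assms by (meson coprime_common_divisor poly_eq_0_iff_dvd)
  thus False
    by (simp add: is_unit_iff_degree)
qed

lemma ratfun_X_minus_const: "ratfun_X - ratfun_const a = to_fract [:-a, 1:]"
  by (simp add: ratfun_X_def ratfun_const_def flip: to_fract_diff)

lemma ratfun_den_nonzero: "ratfun_den f \<noteq> 0"
  using num_den_lowest_terms(2)[of f] by auto

lemma ratfun_num_root_not_den:
  "poly (ratfun_num f) z = 0 \<Longrightarrow> poly (ratfun_den f) z \<noteq> 0"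
  by (rule coprime_no_common_root[OF num_den_lowest_terms(1)])

lemma ratfun_num_nonzero:
  fixes f :: "'a::field_char_0 ratfun"
  assumes "finite (zeros_and_poles f)"
  shows "ratfun_num f \<noteq> 0"
proof
  assume "ratfun_num f = 0"
  hence "zeros_and_poles f = UNIV"
    by (auto simp: zeros_and_poles_def)
  thus False
    using assms infinite_UNIV_char_0 by metis
qed

text \<open>The exponent is the order in the numerator minus the order in the denominator; by
  coprimality exactly one of them is nonzero. The enumeration \<open>\<alpha>\<close> is arbitrary,
  so that it can be matched with that of the target family.\<close>

lemma factored_as_zeros_and_poles:
  fixes f :: "'a::{alg_closed_field, field_char_0} ratfun"
  assumes inj: "inj_on \<alpha> {1..n}" and Z: "\<alpha> ` {1..n} = zeros_and_poles f"
  shows "\<exists>e. factored_as n f \<alpha> e"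
proof -
  define P Q where "P = ratfun_num f" and "Q = ratfun_den f"
  define e where "e u = int (order (\<alpha> u) P) - int (order (\<alpha> u) Q)" for u
  have "finite (zeros_and_poles f)"
    using Z by (metis finite_atLeastAtMost finite_imageI)
  hence nz: "P \<noteq> 0" "Q \<noteq> 0"
    by (simp_all add: P_def Q_def ratfun_num_nonzero ratfun_den_nonzero)
  have prod_eq: "to_fract p = ratfun_const (lead_coeff p)
      * (\<Prod>u=1..n. (ratfun_X - ratfun_const (\<alpha> u)) ^ order (\<alpha> u) p)"
    if "p \<noteq> 0" "{z. poly p z = 0} \<subseteq> \<alpha> ` {1..n}" for p
  proof -
    have "p = smult (lead_coeff p) (\<Prod>z\<in>\<alpha> ` {1..n}. [:-z, 1:] ^ order z p)"
      by (rule poly_eq_prod_roots) (use that in auto)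
    also have "\<dots> = [:lead_coeff p:] * (\<Prod>u=1..n. [:- \<alpha> u, 1:] ^ order (\<alpha> u) p)"
      unfolding prod.reindex[OF inj] o_def by simp
    finally have "to_fract p
        = to_fract ([:lead_coeff p:] * (\<Prod>u=1..n. [:- \<alpha> u, 1:] ^ order (\<alpha> u) p))"
      by (rule arg_cong)
    thus ?thesis
      unfolding to_fract_mult to_fract_prod to_fract_power ratfun_const_def[of "lead_coeff p"]
        ratfun_X_minus_const .
  qed
  have "P \<noteq> 0 \<and> {z. poly P z = 0} \<subseteq> \<alpha> ` {1..n}" "Q \<noteq> 0 \<and> {z. poly Q z = 0} \<subseteq> \<alpha> ` {1..n}"
    unfolding Z using nz by (auto simp: zeros_and_poles_def P_def Q_def)
  \<comment> \<open>Facts 1 and 3 concern \<open>P\<close>, facts 2 and 4 concern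
    \<open>Q\<close>.\<close>
  note PQ = this[THEN conjunct1] this[THEN conjunct2]
  have "f = to_fract P / to_fract Q"
    unfolding P_def Q_def Fract_conv_to_fract[symmetric] by (rule num_den_lowest_terms(3))
  also have "\<dots> = ratfun_const (lead_coeff P) *
      ((\<Prod>u=1..n. (ratfun_X - ratfun_const (\<alpha> u)) ^ order (\<alpha> u) P) /
       (\<Prod>u=1..n. (ratfun_X - ratfun_const (\<alpha> u)) ^ order (\<alpha> u) Q))"
    using prod_eq[OF PQ(1,3)] prod_eq[OF PQ(2,4)] num_den_lowest_terms(2)[of f]
    by (simp add: Q_def ratfun_const_def flip: one_pCons)
  also have "\<dots> = ratfun_const (lead_coeff P) *
      (\<Prod>u=1..n. (ratfun_X - ratfun_const (\<alpha> u)) powi e u)"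
    unfolding prod_dividef[symmetric] e_def
    by (intro arg_cong2[of _ _ _ _ "(*)"] prod.cong refl)
       (subst power_int_diff, auto simp: ratfun_X_minus_const)
  finally have "f = ratfun_const (lead_coeff P) *
      (\<Prod>u=1..n. (ratfun_X - ratfun_const (\<alpha> u)) powi e u)" .
  moreover have "e u \<noteq> 0" if "u \<in> {1..n}" for u
  proof -
    have "\<alpha> u \<in> zeros_and_poles f"
      using that Z by blast
    hence "(order (\<alpha> u) P = 0) \<noteq> (order (\<alpha> u) Q = 0)"
      using ratfun_num_root_not_den[of f] nz
      by (auto simp: zeros_and_poles_def order_eq_0_iff P_def Q_def)
    thus ?thesis
      by (auto simp: e_def)
  qed
  ultimately show ?thesis
    using inj nz unfolding factored_as_def
    by (intro exI[of _ e] exI[of _ "lead_coeff P"] conjI ballI) auto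
qed

subsection \<open>Zeros and poles of a composite\<close>

text \<open>The binary form attached to \<open>P\<close>, evaluated at \<open>(p, q)\<close>: it is
  \<open>P(p/q)\<close> cleared of denominators, and remains meaningful where \<open>q\<close>
  vanishes.\<close>

definition homogenize :: "'a::field poly \<Rightarrow> 'a poly \<Rightarrow> 'a poly \<Rightarrow> 'a poly" where
  "homogenize P p q = (\<Sum>i\<le>degree P. smult (coeff P i) (p ^ i * q ^ (degree P - i)))"

lemma poly_at_ratfun_quot:
  assumes "q \<noteq> 0"
  shows "poly_at_ratfun P (quot p q) = to_fract (homogenize P p q) / to_fract q ^ degree P"
proof -
  have const: "ratfun_const c = 0 \<longleftrightarrow> c = 0" for c :: 'a
    by (simp add: ratfun_const_def)
  have smult: "to_fract (smult c r) = ratfun_const c * to_fract r" for c :: 'a and r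
    by (simp add: ratfun_const_def flip: to_fract_mult)
  have deg: "degree (map_poly ratfun_const P) = degree P"
    by (rule degree_map_poly) (simp add: const)
  have "poly_at_ratfun P (quot p q) * to_fract q ^ degree P =
      (\<Sum>i\<le>degree P. ratfun_const (coeff P i) * (to_fract p / to_fract q) ^ i * to_fract q ^ degree P)"
    unfolding poly_at_ratfun_def Fract_conv_to_fract poly_altdef deg sum_distrib_right
    by (simp add: coeff_map_poly const)
  also have "\<dots> = to_fract (homogenize P p q)"
    unfolding homogenize_def to_fract_sum
  proof (intro sum.cong refl)
    fix i assume "i \<in> {..degree P}"
    hence "to_fract q ^ degree P = to_fract q ^ i * to_fract q ^ (degree P - i)"
      by (simp flip: power_add)
    thus "ratfun_const (coeff P i) * (to_fract p / to_fract q) ^ i * to_fract q ^ degree P =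
        to_fract (smult (coeff P i) (p ^ i * q ^ (degree P - i)))"
      using assms by (simp add: smult to_fract_power power_divide)
  qed
  finally show ?thesis
    using assms by (simp add: field_simps)
qed

lemma poly_homogenize:
  assumes "poly q z \<noteq> 0"
  shows "poly (homogenize P p q) z = poly q z ^ degree P * poly P (poly p z / poly q z)"
  unfolding homogenize_def poly_sum poly_altdef[of P] sum_distrib_left
proof (intro sum.cong refl)
  fix i assume "i \<in> {..degree P}"
  hence "poly q z ^ degree P = poly q z ^ i * poly q z ^ (degree P - i)"
    by (simp flip: power_add)
  thus "poly (smult (coeff P i) (p ^ i * q ^ (degree P - i))) z =
      poly q z ^ degree P * (coeff P i * (poly p z / poly q z) ^ i)"
    using assms by (simp add: power_divide)
qed

text \<open>Only the top term is free of \<open>q\<close>. The value is nonzero if \<open>P\<close>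
  and \<open>poly p z\<close> are, which gives control over \<open>g\<close> at infinity.\<close>

lemma poly_homogenize_at_pole:
  assumes "poly q z = 0"
  shows "poly (homogenize P p q) z = lead_coeff P * poly p z ^ degree P"
proof -
  have "poly (homogenize P p q) z =
      (\<Sum>i\<le>degree P. if i = degree P then lead_coeff P * poly p z ^ degree P else 0)"
    unfolding homogenize_def poly_sum
    by (intro sum.cong refl) (use assms in \<open>auto simp: power_0_left\<close>)
  thus ?thesis
    by simp
qed

text \<open>The formula for \<open>g(h(x))\<close> as an identity of polynomials. It can be
  evaluated at every point, whether or not the fraction built from the two forms is reduced.\<close>

lemma ratfun_compose_cross_mult:
  fixes g h :: "'a::field ratfun"
  defines "f \<equiv> ratfun_compose g h"
  defines "P \<equiv> ratfun_num g" and "Q \<equiv> ratfun_den g"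
  defines "p \<equiv> ratfun_num h" and "q \<equiv> ratfun_den h"
  assumes "f \<noteq> 0"
  shows "ratfun_num f * (homogenize Q p q * q ^ degree P)
       = ratfun_den f * (homogenize P p q * q ^ degree Q)"
proof -
  have q: "q \<noteq> 0"
    by (simp add: q_def ratfun_den_nonzero)
  have h: "h = quot p q"
    unfolding p_def q_def by (rule num_den_lowest_terms(3))
  have f: "f = (to_fract (homogenize P p q) / to_fract q ^ degree P) /
      (to_fract (homogenize Q p q) / to_fract q ^ degree Q)"
    unfolding f_def ratfun_compose_def P_def[symmetric] Q_def[symmetric] h
    by (simp only: poly_at_ratfun_quot[OF q])
  \<comment> \<open>Otherwise division by zero would make \<open>f\<close> zero.\<close>
  have nz: "homogenize Q p q \<noteq> 0"
    using f \<open>f \<noteq> 0\<close> by auto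
  have "to_fract (ratfun_num f) / to_fract (ratfun_den f) = f"
    unfolding Fract_conv_to_fract[symmetric] by (rule num_den_lowest_terms(3)[symmetric])
  also note f
  finally have "to_fract (ratfun_num f * (homogenize Q p q * q ^ degree P))
      = to_fract (ratfun_den f * (homogenize P p q * q ^ degree Q))"
    using nz q ratfun_den_nonzero[of f] by (simp add: to_fract_power field_simps)
  thus ?thesis
    by (simp only: to_fract_eq_iff)
qed

text \<open>Here \<open>h\<close> takes the value \<open>b\<close> at \<open>z\<close>, and exactly
  one of the numerator and denominator of \<open>g\<close> vanishes at \<open>b\<close>. So one side
  of the cross-multiplied identity is 0 at \<open>z\<close>, which forces a zero of the numerator or
  denominator of \<open>f\<close> on the other side.\<close>

lemma finite_fibre_in_zeros_and_poles:
  fixes g h :: "'a::field ratfun"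
  assumes "ratfun_compose g h \<noteq> 0" "b \<in> zeros_and_poles g"
    and z: "poly (ratfun_num h - smult b (ratfun_den h)) z = 0"
  shows "z \<in> zeros_and_poles (ratfun_compose g h)"
proof -
  define p q where "p = ratfun_num h" and "q = ratfun_den h"
  have pz: "poly p z = b * poly q z"
    using z by (simp add: p_def q_def)
  have "poly q z \<noteq> 0"
    using ratfun_num_root_not_den[of h z] pz by (auto simp: p_def q_def)
  moreover from this have "poly p z / poly q z = b"
    by (simp add: pz)
  ultimately show ?thesis
    using arg_cong[OF ratfun_compose_cross_mult[OF assms(1)], of "\<lambda>r. poly r z", folded p_def q_def]
      ratfun_num_root_not_den[of g b] assms(2)
    by (auto simp: poly_homogenize zeros_and_poles_def)
qed

text \<open>The fibre over infinity. After cancelling the common power of \<open>q\<close>, a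
  positive power of \<open>q\<close> remains on one side only, while neither form vanishes at
  \<open>z\<close>.\<close>

lemma pole_in_zeros_and_poles:
  fixes g h :: "'a::field ratfun"
  assumes "ratfun_compose g h \<noteq> 0" "ratfun_num g \<noteq> 0"
    and deg: "degree (ratfun_num g) \<noteq> degree (ratfun_den g)"
    and z: "poly (ratfun_den h) z = 0"
  shows "z \<in> zeros_and_poles (ratfun_compose g h)"
proof -
  define P Q p q where "P = ratfun_num g" and "Q = ratfun_den g"
    and "p = ratfun_num h" and "q = ratfun_den h"
  note defs = P_def Q_def p_def q_def
  define f where "f = ratfun_compose g h"
  have q: "q \<noteq> 0"
    by (simp add: q_def ratfun_den_nonzero)
  have pz: "poly p z \<noteq> 0" and qz: "poly q z = 0"
    using ratfun_num_root_not_den[of h z] z by (auto simp: p_def q_def)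
  have hom: "poly (homogenize P p q) z \<noteq> 0" "poly (homogenize Q p q) z \<noteq> 0"
    using pz qz assms(2) ratfun_den_nonzero[of g] by (simp_all add: poly_homogenize_at_pole defs)
  have eq: "ratfun_num f * (homogenize Q p q * q ^ degree P)
      = ratfun_den f * (homogenize P p q * q ^ degree Q)"
    unfolding f_def defs by (rule ratfun_compose_cross_mult[OF assms(1)])
  show ?thesis
  proof (cases "degree P < degree Q")
    case True
    hence "q ^ degree Q = q ^ degree P * q ^ (degree Q - degree P)"
      by (simp flip: power_add)
    hence "q ^ degree P * (ratfun_num f * homogenize Q p q)
        = q ^ degree P * (ratfun_den f * homogenize P p q * q ^ (degree Q - degree P))"
      using eq by (simp add: mult_ac)
    hence "ratfun_num f * homogenize Q p q
        = ratfun_den f * homogenize P p q * q ^ (degree Q - degree P)"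
      using q by simp
    from arg_cong[OF this, of "\<lambda>r. poly r z"] show ?thesis
      using hom qz True by (auto simp: power_0_left zeros_and_poles_def f_def)
  next
    case False
    hence less: "degree Q < degree P"
      using deg by (simp add: defs)
    hence "q ^ degree P = q ^ degree Q * q ^ (degree P - degree Q)"
      by (simp flip: power_add)
    hence "q ^ degree Q * (ratfun_den f * homogenize P p q)
        = q ^ degree Q * (ratfun_num f * homogenize Q p q * q ^ (degree P - degree Q))"
      using eq[symmetric] by (simp add: mult_ac)
    hence "ratfun_den f * homogenize P p q
        = ratfun_num f * homogenize Q p q * q ^ (degree P - degree Q)"
      using q by simp
    from arg_cong[OF this, of "\<lambda>r. poly r z"] show ?thesis
      using hom qz less by (auto simp: power_0_left zeros_and_poles_def f_def)
  qed
qed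

section \<open>Functions with at most two zeros and poles on the projective line\<close>

text \<open>The constant \<open>k\<close> is absorbed into the numerator through an
  \<open>m\<close>-th root.\<close>

lemma power_of_fractional_linearI:
  fixes g :: "'a::alg_closed_field ratfun"
  assumes "g = quot (smult k ([:b, a:] ^ m)) ([:e, c:] ^ m)"
    and "a * e - b * c \<noteq> 0" "k \<noteq> 0" "m > 0"
  shows "\<exists>l\<in>fractional_linear. \<exists>m::nat. g = l ^ m"
proof -
  obtain y where y: "y ^ m = k"
    using nth_root_exists[OF assms(4)] by blast
  have "y \<noteq> 0"
    using y assms(3,4) by auto
  have "(y * a) * e - (y * b) * c = y * (a * e - b * c)"
    by (simp add: algebra_simps)
  also have "\<dots> \<noteq> 0"
    using assms(2) \<open>y \<noteq> 0\<close> by simp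
  finally have "quot [:y * b, y * a:] [:e, c:] \<in> fractional_linear"
    unfolding fractional_linear_def by blast
  moreover have "smult k ([:b, a:] ^ m) = [:y * b, y * a:] ^ m"
    using smult_power[of y "[:b, a:]" m] by (simp add: y)
  hence "g = quot [:y * b, y * a:] [:e, c:] ^ m"
    unfolding assms(1) by (simp add: Fract_conv_to_fract to_fract_power power_divide)
  ultimately show ?thesis
    by blast
qed

lemma poly_eq_power_if_single_root:
  fixes p :: "'a::alg_closed_field poly"
  assumes "p \<noteq> 0" "{z. poly p z = 0} \<subseteq> {b}"
  shows "p = smult (lead_coeff p) ([:-b, 1:] ^ degree p)"
  using poly_eq_prod_roots[OF assms(1) _ assms(2)] sum_order_eq_degree[OF assms(1) _ assms(2)]
  by simp

text \<open>The second alternative counts the point at infinity, which is a zero or pole of \<open>g\<close>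
  iff its numerator and denominator differ in degree.\<close>

lemma three_zeros_and_poles:
  fixes g :: "'a::{alg_closed_field, field_char_0} ratfun"
  assumes g: "ratfun_degree g > 0" "\<not> (\<exists>l\<in>fractional_linear. \<exists>m::nat. g = l ^ m)"
    and fin: "finite (zeros_and_poles g)"
  shows "card (zeros_and_poles g) \<ge> 3 \<or>
    card (zeros_and_poles g) \<ge> 2 \<and> degree (ratfun_num g) \<noteq> degree (ratfun_den g)"
proof (rule ccontr)
  define P Q where "P = ratfun_num g" and "Q = ratfun_den g"
  define R where "R = zeros_and_poles g"
  assume contra: "\<not> ?thesis"
  have nz: "P \<noteq> 0" "Q \<noteq> 0"
    using fin by (simp_all add: P_def Q_def ratfun_num_nonzero ratfun_den_nonzero)
  have g_eq: "g = quot P Q" and lcQ: "lead_coeff Q = 1"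
    unfolding P_def Q_def by (rule num_den_lowest_terms)+
  have disj: "poly Q z \<noteq> 0" if "poly P z = 0" for z
    using that ratfun_num_root_not_den[of g] by (simp add: P_def Q_def)
  have R: "R = {z. poly P z = 0} \<union> {z. poly Q z = 0}"
    by (auto simp: R_def zeros_and_poles_def P_def Q_def)
  have root: "\<exists>z. poly p z = 0" if "degree p > 0" for p :: "'a poly"
    using that alg_closed_imp_poly_has_root by blast
  have pos: "degree P > 0 \<or> degree Q > 0"
    using g(1) by (auto simp: ratfun_degree_def P_def Q_def)
  have finR: "finite R"
    using fin by (simp add: R_def)
  show False
  \<comment> \<open>If both are nonconstant, \<open>g\<close> has one zero \<open>b\<close> and one
    pole \<open>c\<close>, of equal order. Otherwise infinity is a zero or pole, and one finite
    point \<open>b\<close> remains.\<close>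
  proof (cases "degree P > 0 \<and> degree Q > 0")
    case True
    then obtain b c where bc: "poly P b = 0" "poly Q c = 0"
      using root by blast
    hence "b \<noteq> c"
      using disj by auto
    moreover have "{b, c} \<subseteq> R"
      using bc by (auto simp: R)
    moreover from this have "card {b, c} \<le> card R"
      by (intro card_mono finR)
    ultimately have card: "card R = 2" and deg: "degree P = degree Q"
      using contra by (auto simp: R_def P_def Q_def)
    hence "R = {b, c}"
      using \<open>b \<noteq> c\<close> \<open>{b, c} \<subseteq> R\<close> finR by (metis card_2_iff card_subset_eq)
    hence sub: "{z. poly P z = 0} \<subseteq> {b}" "{z. poly Q z = 0} \<subseteq> {c}"
      using bc disj R by auto
    have "g = quot (smult (lead_coeff P) ([:-b, 1:] ^ degree P)) ([:-c, 1:] ^ degree P)"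
      using poly_eq_power_if_single_root[OF nz(1) sub(1)]
        poly_eq_power_if_single_root[OF nz(2) sub(2)] g_eq lcQ deg by simp
    from power_of_fractional_linearI[OF this] show False
      using g(2) \<open>b \<noteq> c\<close> nz True by simp
  next
    case False
    hence "degree P \<noteq> degree Q"
      using pos by auto
    hence "card R \<le> 1"
      using contra by (auto simp: R_def P_def Q_def)
    moreover have "R \<noteq> {}"
      using pos root by (auto simp: R)
    ultimately obtain b where b: "R = {b}"
      using finR by (metis card_0_eq card_1_singletonE le_antisym less_one not_le)
    hence sub: "{z. poly P z = 0} \<subseteq> {b}" "{z. poly Q z = 0} \<subseteq> {b}"
      using R by auto
    note PQ = poly_eq_power_if_single_root[OF nz(1) sub(1)]
      poly_eq_power_if_single_root[OF nz(2) sub(2)]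
    show False
    proof (cases "degree P > 0")
      case True
      \<comment> \<open>The constant 1 is written as \<open>[:1, 0:]\<close> to fit the shape of a
        fractional linear function.\<close>
      hence "g = quot (smult (lead_coeff P) ([:-b, 1:] ^ degree P)) ([:1, 0:] ^ degree P)"
        using PQ False g_eq lcQ by (simp flip: one_pCons)
      from power_of_fractional_linearI[OF this] show False
        using g(2) nz True by simp
    next
      case P0: False
      hence "g = quot (smult (lead_coeff P) ([:1, 0:] ^ degree Q)) ([:-b, 1:] ^ degree Q)"
        using PQ False g_eq lcQ by (simp flip: one_pCons)
      from power_of_fractional_linearI[OF this] show False
        using g(2) nz pos P0 by simp
    qed
  qed
qed

section \<open>Reduction to family (c)\<close>

text \<open>With both parameters 1, the exponents 2, 1, 1 are nonzero and the parameters have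
  nonzero sum.\<close>

lemma family_c_factored_as:
  assumes "x \<noteq> y"
  shows "factored_as 3 (family_c x y 1 1) (\<lambda>u. if u = 1 then (x + y) / 2 else if u = 2 then x else y)
    (\<lambda>u. if u = 1 then 2 else 1)"
proof -
  have "(x + y) / 2 \<noteq> x" "(x + y) / 2 \<noteq> y"
    using assms by (auto simp: field_simps)
  moreover have set: "{1..3} = {1, 2, 3::nat}"
    by auto
  ultimately show ?thesis
    unfolding factored_as_def set using assms
    by (auto simp: inj_on_def family_c_def ratfun_const_def mult.assoc
          simp flip: one_pCons intro!: exI[of _ 1])
qed

theorem theorem2:
  fixes f g h :: "'a::{alg_closed_field, field_char_0} ratfun"
  assumes "f = ratfun_compose g h"
    and "ratfun_degree g \<ge> 2"
    and "ratfun_degree h \<ge> 2"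
    and "\<not> (\<exists>l\<in>fractional_linear. \<exists>m::nat. g = l ^ m)"
    and "card (zeros_and_poles f) = 3"
  shows "(\<exists>\<alpha>\<^sub>1 k\<^sub>1 k\<^sub>2. k\<^sub>1 + k\<^sub>2 \<noteq> 0 \<and> ratfun_equivalent 3 f (family_a \<alpha>\<^sub>1 k\<^sub>1 k\<^sub>2))
       \<or> (\<exists>\<alpha>\<^sub>1 \<alpha>\<^sub>2 k\<^sub>1 k\<^sub>2. k\<^sub>1 + k\<^sub>2 \<noteq> 0 \<and> ratfun_equivalent 3 f (family_b \<alpha>\<^sub>1 \<alpha>\<^sub>2 k\<^sub>1 k\<^sub>2))
       \<or> (\<exists>\<alpha>\<^sub>1 \<alpha>\<^sub>2 k\<^sub>1 k\<^sub>2. k\<^sub>1 + k\<^sub>2 \<noteq> 0 \<and> ratfun_equivalent 3 f (family_c \<alpha>\<^sub>1 \<alpha>\<^sub>2 k\<^sub>1 k\<^sub>2))"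
proof -
  have "ratfun_degree g > 0"
    using assms(2) by simp
  have "\<exists>x y. x \<noteq> y \<and> zeros_and_poles f = {x, y, (x + y) / 2}"
  proof -
    define p q where "p = ratfun_num h" and "q = ratfun_den h"
    \<comment> \<open>The roots of \<open>L b\<close> form the fibre of \<open>h\<close> over
      \<open>b\<close>; those of \<open>q\<close> form the fibre over infinity.\<close>
    define L where "L b = p - smult b q" for b
    have fin: "finite (zeros_and_poles f)"
      using assms(5) by (intro card_ge_0_finite) simp
    have "f \<noteq> 0"
    proof
      assume "f = 0"
      hence "to_fract (ratfun_num f) / to_fract (ratfun_den f) = 0"
        using num_den_lowest_terms(3)[of f] by (simp add: Fract_conv_to_fract)
      thus False
        using ratfun_num_nonzero[OF fin] ratfun_den_nonzero[of f] by simp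
    qed
    have "ratfun_num g \<noteq> 0"
      using \<open>f \<noteq> 0\<close> by (auto simp: assms(1) ratfun_compose_def poly_at_ratfun_def)
    hence finR: "finite (zeros_and_poles g)"
      using ratfun_den_nonzero[of g]
      by (simp add: poly_roots_finite zeros_and_poles_def Collect_disj_eq)
    have pq: "poly q z \<noteq> 0" if "poly p z = 0" for z
      using that ratfun_num_root_not_den[of h] by (simp add: p_def q_def)
    have degh: "max (degree p) (degree q) \<ge> 2"
      using assms(3) by (simp add: ratfun_degree_def p_def q_def)
    have L_root: "z \<in> zeros_and_poles f" if "b \<in> zeros_and_poles g" "poly (L b) z = 0" for b z
      using finite_fibre_in_zeros_and_poles[of g h b z] that \<open>f \<noteq> 0\<close> by (simp add: assms(1) L_def p_def q_def)
    have L_disj: "poly (L c) z \<noteq> 0" if "poly (L b) z = 0" "b \<noteq> c" for b c z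
      using that pq[of z] by (auto simp: L_def)
    \<comment> \<open>For distinct \<open>b\<close> and \<open>c\<close>, both \<open>p\<close> and
      \<open>q\<close> are linear combinations of \<open>L b\<close> and \<open>L c\<close>, so
      these cannot both have degree below 2.\<close>
    have L_deg: "max (degree (L b)) (degree (L c)) \<ge> 2" if "b \<noteq> c" for b c
    proof (rule ccontr)
      assume *: "\<not> ?thesis"
      have "smult (c - b) q = L b - L c" "smult (c - b) p = smult c (L b) - smult b (L c)"
        by (auto simp: L_def algebra_simps smult_diff_left smult_diff_right)
      moreover have "degree (L b - L c) < 2" "degree (smult c (L b) - smult b (L c)) < 2"
        using * by (intro degree_diff_less; auto intro: le_less_trans[OF degree_smult_le])+
      ultimately show False
        using degh that by (metis degree_smult_eq max_def not_le right_minus_eq)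
    qed
    \<comment> \<open>Three zeros or poles of \<open>g\<close>: all finite, or two finite ones and
      infinity.\<close>
    consider b c d where "{b, c, d} \<subseteq> zeros_and_poles g" "b \<noteq> c" "b \<noteq> d" "c \<noteq> d"
      | b c where "{b, c} \<subseteq> zeros_and_poles g" "b \<noteq> c" "degree (ratfun_num g) \<noteq> degree (ratfun_den g)"
      using three_zeros_and_poles[OF \<open>ratfun_degree g > 0\<close> assms(4) finR]
    proof (elim disjE conjE)
      assume "3 \<le> card (zeros_and_poles g)"
      then obtain T where "T \<subseteq> zeros_and_poles g" "card T = 3"
        using obtain_subset_with_card_n by metis
      thus thesis
        using that(1) by (auto simp: card_3_iff)
    next
      assume "2 \<le> card (zeros_and_poles g)" "degree (ratfun_num g) \<noteq> degree (ratfun_den g)"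
      moreover from this obtain T where "T \<subseteq> zeros_and_poles g" "card T = 2"
        using obtain_subset_with_card_n by metis
      ultimately show thesis
        using that(2) by (auto simp: card_2_iff)
    qed
    thus ?thesis
    proof cases
      case 1
      \<comment> \<open>These coefficients cancel both \<open>p\<close> and \<open>q\<close>, and
        are nonzero, so the roots are unaffected.\<close>
      have sum: "smult (c - d) (L b) + smult (d - b) (L c) + smult (b - c) (L d) = 0"
        by (simp add: L_def algebra_simps smult_diff_left smult_diff_right)
      show ?thesis
        using 1 L_deg[OF 1(2)] L_disj[of b _ c]
        by (intro pencil_midpoint[OF sum _ assms(5)]) (auto intro: L_root)
    next
      case 2
      \<comment> \<open>The third member is now a multiple of \<open>q\<close>, for the fibre over
        infinity.\<close>
      have sum: "L b + (- L c) + smult (b - c) q = 0"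
        by (simp add: L_def algebra_simps smult_diff_left)
      have "z \<in> zeros_and_poles f" if "poly q z = 0" for z
        using pole_in_zeros_and_poles[of g h z] \<open>f \<noteq> 0\<close> \<open>ratfun_num g \<noteq> 0\<close> 2(3) that
        by (simp add: assms(1) q_def)
      thus ?thesis
        using 2 L_deg[OF 2(2)] L_disj[of b _ c]
        by (intro pencil_midpoint[OF sum _ assms(5)]) (auto intro: L_root)
    qed
  qed
  then obtain x y where xy: "x \<noteq> y" "zeros_and_poles f = {x, y, (x + y) / 2}"
    by blast
  define \<alpha> where "\<alpha> u = (if u = 1 then (x + y) / 2 else if u = 2 then x else y)" for u :: nat
  note family = family_c_factored_as[OF xy(1), folded \<alpha>_def]
  have set: "{1..3} = {1, 2, 3::nat}"
    by auto
  have inj: "inj_on \<alpha> {1..3}"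
    using family by (simp add: factored_as_def)
  have "\<alpha> ` {1..3} = zeros_and_poles f"
    unfolding set xy(2) by (auto simp: \<alpha>_def)
  from factored_as_zeros_and_poles[OF inj this]
  obtain e where e: "factored_as 3 f \<alpha> e"
    by blast
  \<comment> \<open>The identity matrix with zero translation. The condition
    \<open>3 + 1 = u\<close> is always false here; it is the entry rule \<open>v = u\<close> at the
    last column.\<close>
  have "\<alpha> u = (\<Sum>v=1..3. of_rat (if v = u then 1 else 0) * \<alpha> v) + of_rat (if 3 + 1 = u then 1 else 0)"
    if "u \<in> {1..3}" for u
    using that unfolding set by auto
  hence "\<forall>u\<in>{1..3}. \<alpha> u = (\<Sum>v=1..3. of_rat (if v = u then 1 else 0) * \<alpha> v)
      + of_rat (if 3 + 1 = u then 1 else 0)"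
    by blast
  hence "ratfun_equivalent 3 f (family_c x y 1 1)"
    unfolding ratfun_equivalent_def using e family by (intro exI conjI)
  thus ?thesis
    by (intro disjI2) (force intro: exI[of _ 1])
qed

end
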